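(* Let $d\in\mathbb N$, $d\geq 1$, and let $C:\mathbb R^d\to\mathbb R$ be a stationary correlation function satisfying all of the following: (a) $C$ is continuous; (b) with $d_C(\boldsymbol x,\boldsymbol x')=\sqrt{2C(\boldsymbol 0)-2C(\boldsymbol x-\boldsymbol x')}$ and $N([0,1]^d,d_C,\rho)$ the minimum number of balls of radius $\rho$ (with respect to the distance $d_C$) required to cover $[0,1]^d$, one has $\int_0^\infty\sqrt{\ln\{N([0,1]^d,d_C,\rho)\}}\,d\rho<\infty$; (c) the Fourier transform $\widehat C$ of $C$ satisfies: there exists $P<\infty$ such that $\widehat C(\boldsymbol w)\|\boldsymbol w\|^P\to\infty$ as $\|\boldsymbol w\|\to\infty$; (d) $C(\boldsymbol 0)=1$ and $C(\boldsymbol x)<1$ for $\boldsymbol x\ne\boldsymbol 0$. Let $Y$ be a zero-mean Gaussian process on $[0,1]^d$ with covariance function $\sigma_0^2C$, i.e. $\mathrm{cov}\{Y(\boldsymbol x),Y(\boldsymbol x')\}=\sigma_0^2C(\boldsymbol x-\boldsymbol x')$, with fixed $\sigma_0^2\in(0,\infty)$. Let $(\boldsymbol x_i)_{i\in\mathbb N}$ be a sequence of pairwise distinct observation points in $[0,1]^d$ and let $\{w_{i,j}^{(n)}\}_{n\in\mathbb N,1\le i<j\le n}$ be a triangular array of weights in $[0,\infty)$ such that, for every $n\ge2$, not all $w^{(n)}_{i,j}$ are zero. Then the weighted pairwise maximum likelihood estimator $\hat\sigma^2_{C,p\ell}$ does not converge to $\sigma_0^2$ in probability as $n\to\infty$.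
   Context: Writing $w_{i,j}=w^{(n)}_{i,j}$, define for $\sigma^2\in(0,\infty)$ $$\ell_{C,\boldsymbol x_i,\boldsymbol x_j}(\sigma^2)=2\ln(\sigma^2)+\ln(1-C(\boldsymbol x_i-\boldsymbol x_j)^2)+\frac1{\sigma^2}Y(\boldsymbol x_i)^2+\frac{\{Y(\boldsymbol x_j)-C(\boldsymbol x_i-\boldsymbol x_j)Y(\boldsymbol x_i)\}^2}{\sigma^2(1-C(\boldsymbol x_i-\boldsymbol x_j)^2)},$$ $$p\ell_{C,n}(\sigma^2)=\sum_{i=1}^{n-1}\sum_{j=i+1}^nw_{i,j}\,\ell_{C,\boldsymbol x_i,\boldsymbol x_j}(\sigma^2).$$ The correlation function $C$ is known. The estimator $\hat\sigma^2_{C,p\ell}$ (depending on $n$) is the solution of $p\ell_{C,n}(\hat\sigma^2_{C,p\ell})=\min_{\sigma^2\in(0,\infty)}p\ell_{C,n}(\sigma^2)$. A stationary correlation function is a function $C:\mathbb R^d\to\mathbb R$ such that $(\boldsymbol x,\boldsymbol x')\mapsto C(\boldsymbol x-\boldsymbol x')$ is symmetric and positive semi-definite, with $C(\boldsymbol 0)=1$. *)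

theory Defs
  imports "HOL-Probability.Probability"
begin

definition unit_cube :: "(real ^ 'd) set" where
  "unit_cube = {x. \<forall>i. 0 \<le> x $ i \<and> x $ i \<le> 1}"

definition stationary_correlation :: "(real ^ 'd \<Rightarrow> real) \<Rightarrow> bool" where
  "stationary_correlation C \<longleftrightarrow>
     (\<forall>x x'. C (x - x') = C (x' - x)) \<and>
     (\<forall>(m::nat) x a. 0 \<le> (\<Sum>i<m. \<Sum>j<m. a i * a j * C (x i - x j))) \<and>
     C 0 = 1"

definition corr_dist :: "(real ^ 'd \<Rightarrow> real) \<Rightarrow> real ^ 'd \<Rightarrow> real ^ 'd \<Rightarrow> real" where
  "corr_dist C x x' = sqrt (2 * C 0 - 2 * C (x - x'))"

(* Closed balls with centres in T.  The infimum is over a nonempty set whenever T is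
   totally bounded for D and r > 0; for the unit cube and the distance of a continuous
   correlation function this always holds. *)
definition covering_number :: "'v set \<Rightarrow> ('v \<Rightarrow> 'v \<Rightarrow> real) \<Rightarrow> real \<Rightarrow> nat" where
  "covering_number T D r =
     Inf {card S | S. finite S \<and> S \<subseteq> T \<and> (\<forall>t\<in>T. \<exists>s\<in>S. D s t \<le> r)}"

definition entropy_integral :: "'v set \<Rightarrow> ('v \<Rightarrow> 'v \<Rightarrow> real) \<Rightarrow> ennreal" where
  "entropy_integral T D =
     (\<integral>\<^sup>+ r\<in>{0<..}. ennreal (sqrt (ln (real (covering_number T D r)))) \<partial>lborel)"

(* F is the Fourier transform of C, normalised by (2 pi)^(-d).  The first alternative is the
   usual integral for absolutely integrable C.  The second one admits correlation functions
   that are not integrable but have a spectral density F, which is then their Fourier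
   transform in the distributional sense.  F is real-valued since C is real and even. *)
definition is_fourier_transform :: "(real ^ 'd \<Rightarrow> real) \<Rightarrow> (real ^ 'd \<Rightarrow> real) \<Rightarrow> bool" where
  "is_fourier_transform C F \<longleftrightarrow>
     (integrable lborel C \<and>
      (\<forall>w. complex_of_real (F w) =
             (LINT x|lborel. complex_of_real (C x) * cis (- (w \<bullet> x))) / (2 * pi) ^ CARD('d)))
   \<or> (integrable lborel F \<and>
      (\<forall>x. complex_of_real (C x) = (LINT w|lborel. complex_of_real (F w) * cis (w \<bullet> x))))"

(* Degenerate (constant) Gaussian variables are included. *)
definition gaussian_rv :: "'a measure \<Rightarrow> ('a \<Rightarrow> real) \<Rightarrow> bool" where
  "gaussian_rv M X \<longleftrightarrow> X \<in> borel_measurable M \<and>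
     ((\<exists>\<mu>. AE \<omega> in M. X \<omega> = \<mu>) \<or>
      (\<exists>\<mu> \<sigma>. 0 < \<sigma> \<and> distributed M lborel X (\<lambda>t. ennreal (normal_density \<mu> \<sigma> t))))"

definition gaussian_process_on ::
    "'a measure \<Rightarrow> 'v set \<Rightarrow> ('v \<Rightarrow> 'a \<Rightarrow> real) \<Rightarrow> bool" where
  "gaussian_process_on M T Y \<longleftrightarrow>
     (\<forall>S a. finite S \<and> S \<subseteq> T \<longrightarrow> gaussian_rv M (\<lambda>\<omega>. \<Sum>t\<in>S. a t * Y t \<omega>))"

definition covariance :: "'a measure \<Rightarrow> ('a \<Rightarrow> real) \<Rightarrow> ('a \<Rightarrow> real) \<Rightarrow> real" where
  "covariance M X Z =
     (LINT \<omega>|M. (X \<omega> - (LINT \<omega>'|M. X \<omega>')) * (Z \<omega> - (LINT \<omega>'|M. Z \<omega>')))"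

(* y is a realisation of the process and s the variance parameter sigma^2. *)
definition pair_lik ::
    "(real ^ 'd \<Rightarrow> real) \<Rightarrow> (real ^ 'd \<Rightarrow> real) \<Rightarrow> real ^ 'd \<Rightarrow> real ^ 'd \<Rightarrow> real \<Rightarrow> real" where
  "pair_lik C y u v s =
     2 * ln s + ln (1 - (C (u - v))\<^sup>2) + 1 / s * (y u)\<^sup>2
     + (y v - C (u - v) * y u)\<^sup>2 / (s * (1 - (C (u - v))\<^sup>2))"

definition pairwise_lik ::
    "(real ^ 'd \<Rightarrow> real) \<Rightarrow> (real ^ 'd \<Rightarrow> real) \<Rightarrow> (nat \<Rightarrow> real ^ 'd) \<Rightarrow>
     (nat \<Rightarrow> nat \<Rightarrow> real) \<Rightarrow> nat \<Rightarrow> real \<Rightarrow> real" where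
  "pairwise_lik C y x w n s =
     (\<Sum>i = 1..n - 1. \<Sum>j = i + 1..n. w i j * pair_lik C y (x i) (x j) s)"

definition converges_in_probability ::
    "'a measure \<Rightarrow> (nat \<Rightarrow> 'a \<Rightarrow> real) \<Rightarrow> real \<Rightarrow> bool" where
  "converges_in_probability M Z c \<longleftrightarrow>
     (\<forall>\<epsilon>>0. (\<lambda>n. measure M {\<omega> \<in> space M. \<epsilon> < \<bar>Z n \<omega> - c\<bar>}) \<longlonglongrightarrow> 0)"

end

theory Submission
  imports Defs
begin

text \<open>
  The objective is \<open>2 W ln s + A / s\<close> up to a constant, where \<open>W\<close> is the total weight, so its minimiser
  \<open>A / (2 W)\<close> is a weighted average \<open>Z = \<Sum> p\<^sub>k X\<^sub>k\<^sup>2\<close> of squares of jointly Gaussian variables \<open>X\<^sub>k\<close> with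
  mean \<open>0\<close> and variance \<open>\<sigma>\<^sub>0\<^sup>2\<close>: the observations \<open>Y(x\<^sub>i)\<close> and the normalised residuals of \<open>Y(x\<^sub>j)\<close> given
  \<open>Y(x\<^sub>i)\<close>. Squares of jointly Gaussian variables are nonnegatively correlated,
  \<open>Cov(X\<^sub>k\<^sup>2, X\<^sub>l\<^sup>2) = 2 E(X\<^sub>k X\<^sub>l)\<^sup>2\<close>, so the variance of \<open>Z\<close> is at least the contribution of the terms \<open>Y(x\<^sub>i)\<^sup>2\<close>.
  The cube is compact and \<open>C\<close> is close to \<open>1\<close> near the origin, so this contribution is bounded away
  from \<open>0\<close> uniformly in \<open>n\<close> and in the weights. The fourth central moment of \<open>Z\<close> is bounded by
  \<open>60 \<sigma>\<^sub>0\<^sup>8\<close>, so convergence in probability would force the variance to tend to \<open>0\<close>.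
\<close>

subsection \<open>Moments of centred Gaussian variables\<close>

text \<open>The factor is the double factorial (2k-1)!!. Writing the even moments through the second
  moment, not through a density parameter, gives one formula for both kinds of Gaussian variable: a
  degenerate centred one is almost surely \<open>0\<close>, and the others have the classical normal
  moments.\<close>

lemma (in prob_space) gaussian_rv_moments:
  assumes "gaussian_rv M X" and mean: "expectation X = 0"
  shows integrable_gaussian_rv_power: "integrable M (\<lambda>\<omega>. X \<omega> ^ k)"
    and expectation_gaussian_rv_even_power:
      "expectation (\<lambda>\<omega>. X \<omega> ^ (2 * k)) =
         fact (2 * k) / (2 ^ k * fact k) * expectation (\<lambda>\<omega>. (X \<omega>)\<^sup>2) ^ k"
proof -
  have [measurable]: "X \<in> borel_measurable M"
    using assms(1) by (simp add: gaussian_rv_def)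
  consider \<mu> where "AE \<omega> in M. X \<omega> = \<mu>"
    | \<mu> \<sigma> where "0 < \<sigma>" "distributed M lborel X (\<lambda>t. ennreal (normal_density \<mu> \<sigma> t))"
    using assms(1) unfolding gaussian_rv_def by blast
  then have "integrable M (\<lambda>\<omega>. X \<omega> ^ k) \<and> expectation (\<lambda>\<omega>. X \<omega> ^ (2 * k)) =
         fact (2 * k) / (2 ^ k * fact k) * expectation (\<lambda>\<omega>. (X \<omega>)\<^sup>2) ^ k"
  proof cases
    case (1 \<mu>)
    have "expectation X = expectation (\<lambda>_. \<mu>)"
      using 1 by (intro integral_cong_AE) auto
    then have "\<mu> = 0" using mean by (simp add: prob_space)
    \<comment> \<open>The form \<open>0 ^ j\<close> also covers \<open>j = 0\<close>, where the
      moment is \<open>1\<close>.\<close>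
    have power: "AE \<omega> in M. X \<omega> ^ j = 0 ^ j" for j
      using 1 \<open>\<mu> = 0\<close> by auto
    have int: "integrable M (\<lambda>\<omega>. X \<omega> ^ j)" and
      ex: "expectation (\<lambda>\<omega>. X \<omega> ^ j) = 0 ^ j" for j
    proof -
      show "integrable M (\<lambda>\<omega>. X \<omega> ^ j)"
        by (subst integrable_cong_AE[OF _ _ power]) auto
      have "expectation (\<lambda>\<omega>. X \<omega> ^ j) = expectation (\<lambda>_. 0 ^ j)"
        by (rule integral_cong_AE[OF _ _ power]) auto
      then show "expectation (\<lambda>\<omega>. X \<omega> ^ j) = 0 ^ j" by (simp add: prob_space)
    qed
    show ?thesis
      using int[of k] ex[of "2 * k"] ex[of 2] by (cases k) (simp_all add: prob_space)
  next
    case (2 \<mu> \<sigma>)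
    have "expectation X = \<mu>"
      using distributed_integral[OF 2(2), of "\<lambda>t. t"] integral_normal_moment_nz_1[OF 2(1), of \<mu>]
      by simp
    then have "\<mu> = 0" using mean by simp
    have int: "integrable M (\<lambda>\<omega>. X \<omega> ^ j)" for j
      using distributed_integrable[OF 2(2), of "\<lambda>t. t ^ j"]
        integrable_normal_moment[OF 2(1), of \<mu> j] \<open>\<mu> = 0\<close> by simp
    have ex: "expectation (\<lambda>\<omega>. X \<omega> ^ (2 * j)) = fact (2 * j) / ((2 / \<sigma>\<^sup>2) ^ j * fact j)" for j
      using distributed_integral[OF 2(2), of "\<lambda>t. t ^ (2 * j)"]
        integral_normal_moment_even[OF 2(1), of \<mu> j] \<open>\<mu> = 0\<close> by simp
    have "expectation (\<lambda>\<omega>. (X \<omega>)\<^sup>2) = \<sigma>\<^sup>2"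
      using ex[of 1] by (simp add: fact_2)
    then show ?thesis
      using int ex[of k] by (simp add: power_divide)
  qed
  then show "integrable M (\<lambda>\<omega>. X \<omega> ^ k)"
    and "expectation (\<lambda>\<omega>. X \<omega> ^ (2 * k)) =
         fact (2 * k) / (2 ^ k * fact k) * expectation (\<lambda>\<omega>. (X \<omega>)\<^sup>2) ^ k"
    by auto
qed

text \<open>The index set is arbitrary, so that the notion fits both the process on the cube and the
  finite family of observations and normalised residuals built from it.\<close>

definition centred_gaussian_family :: "'a measure \<Rightarrow> 'k set \<Rightarrow> ('k \<Rightarrow> 'a \<Rightarrow> real) \<Rightarrow> bool" where
  "centred_gaussian_family M K X \<longleftrightarrow>
     gaussian_process_on M K X \<and> (\<forall>k\<in>K. (LINT \<omega>|M. X k \<omega>) = 0)"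

lemma gaussian_process_on_component:
  assumes "gaussian_process_on M K X" "k \<in> K"
  shows "gaussian_rv M (X k)"
proof -
  have "gaussian_rv M (\<lambda>\<omega>. \<Sum>t\<in>{k}. 1 * X t \<omega>)"
    using assms unfolding gaussian_process_on_def
    by (elim allE[of _ "{k}"] allE[of _ "\<lambda>_. 1"]) auto
  then show ?thesis by simp
qed

lemma (in prob_space) integrable_gaussian_rv:
  assumes "gaussian_rv M X"
  shows "integrable M X"
proof -
  have [measurable]: "X \<in> borel_measurable M"
    using assms(1) by (simp add: gaussian_rv_def)
  consider \<mu> where "AE \<omega> in M. X \<omega> = \<mu>"
    | \<mu> \<sigma> where "0 < \<sigma>" "distributed M lborel X (\<lambda>t. ennreal (normal_density \<mu> \<sigma> t))"
    using assms(1) unfolding gaussian_rv_def by blast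
  then show ?thesis
  proof cases
    case (1 \<mu>)
    then show ?thesis by (subst integrable_cong_AE[where g = "\<lambda>_. \<mu>"]) auto
  next
    case (2 \<mu> \<sigma>)
    then show ?thesis
      using distributed_integrable_var[OF 2(2)] integrable_normal_moment_nz_1[OF 2(1), of \<mu>]
      by simp
  qed
qed

lemma (in prob_space) centred_gaussian_family_lincomb:
  assumes fam: "centred_gaussian_family M K X" and S: "finite S" "S \<subseteq> K"
  shows "gaussian_rv M (\<lambda>\<omega>. \<Sum>t\<in>S. a t * X t \<omega>)"
    and "expectation (\<lambda>\<omega>. \<Sum>t\<in>S. a t * X t \<omega>) = 0"
proof -
  show "gaussian_rv M (\<lambda>\<omega>. \<Sum>t\<in>S. a t * X t \<omega>)"
    using fam S unfolding centred_gaussian_family_def gaussian_process_on_def by blast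
  have "integrable M (X t)" "expectation (X t) = 0" if "t \<in> S" for t
    using fam S that
    by (auto simp: centred_gaussian_family_def
        intro!: integrable_gaussian_rv gaussian_process_on_component)
  then show "expectation (\<lambda>\<omega>. \<Sum>t\<in>S. a t * X t \<omega>) = 0"
    by (simp add: Bochner_Integration.integral_sum)
qed

text \<open>Finite combinations of finite linear combinations are again finite linear combinations,
  so joint Gaussianity passes to the new family.\<close>

lemma (in prob_space) centred_gaussian_family_transform:
  assumes fam: "centred_gaussian_family M T Y"
    and S: "\<And>k. k \<in> K \<Longrightarrow> finite (S k)" "\<And>k. k \<in> K \<Longrightarrow> S k \<subseteq> T"
    and X: "\<And>k \<omega>. k \<in> K \<Longrightarrow> X k \<omega> = (\<Sum>t\<in>S k. b k t * Y t \<omega>)"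
  shows "centred_gaussian_family M K X"
  unfolding centred_gaussian_family_def gaussian_process_on_def
proof (intro conjI allI impI ballI)
  fix J and a :: "'c \<Rightarrow> real" assume J: "finite J \<and> J \<subseteq> K"
  let ?U = "\<Union>k\<in>J. S k"
  have U: "finite ?U" "?U \<subseteq> T" using J S by blast+
  \<comment> \<open>The supports \<open>S k\<close> differ, so the coefficients are extended by zero
    to their union before the sums are exchanged.\<close>
  have "(\<Sum>k\<in>J. a k * X k \<omega>) =
      (\<Sum>t\<in>?U. (\<Sum>k\<in>J. a k * (if t \<in> S k then b k t else 0)) * Y t \<omega>)" for \<omega>
  proof -
    have "(\<Sum>k\<in>J. a k * X k \<omega>) =
        (\<Sum>k\<in>J. \<Sum>t\<in>?U. a k * (if t \<in> S k then b k t else 0) * Y t \<omega>)"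
    proof (rule sum.cong[OF refl])
      fix k assume k: "k \<in> J"
      then have "X k \<omega> = (\<Sum>t\<in>S k. b k t * Y t \<omega>)" using X J by auto
      also have "\<dots> = (\<Sum>t\<in>?U. (if t \<in> S k then b k t else 0) * Y t \<omega>)"
        using k U by (intro sum.mono_neutral_cong_left) auto
      finally show "a k * X k \<omega> = (\<Sum>t\<in>?U. a k * (if t \<in> S k then b k t else 0) * Y t \<omega>)"
        by (simp add: sum_distrib_left mult.assoc)
    qed
    also have "\<dots> = (\<Sum>t\<in>?U. \<Sum>k\<in>J. a k * (if t \<in> S k then b k t else 0) * Y t \<omega>)"
      by (rule sum.swap)
    finally show ?thesis by (simp only: sum_distrib_right)
  qed
  then show "gaussian_rv M (\<lambda>\<omega>. \<Sum>k\<in>J. a k * X k \<omega>)"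
    using centred_gaussian_family_lincomb(1)[OF fam U] by presburger
next
  fix k assume k: "k \<in> K"
  show "expectation (X k) = 0"
    using centred_gaussian_family_lincomb(2)[OF fam S(1)[OF k] S(2)[OF k], of "b k"] X[OF k]
    by presburger
qed

text \<open>The Isserlis (Wick) formula for E(X^2 Y^2). It follows by polarisation from E(Z^4) = 3
  E(Z^2)^2 for the one-dimensional Gaussians X, Y, X + Y and X - Y; no joint density enters, so
  degenerate pairs are covered.\<close>

lemma (in prob_space) gaussian_pair_moments:
  assumes gauss: "\<And>a b. gaussian_rv M (\<lambda>\<omega>. a * X \<omega> + b * Y \<omega>)"
    and mean: "expectation X = 0" "expectation Y = 0"
  shows "integrable M (\<lambda>\<omega>. X \<omega> * Y \<omega>)"
    and "integrable M (\<lambda>\<omega>. (X \<omega>)\<^sup>2 * (Y \<omega>)\<^sup>2)"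
    and "expectation (\<lambda>\<omega>. (X \<omega>)\<^sup>2 * (Y \<omega>)\<^sup>2) =
      expectation (\<lambda>\<omega>. (X \<omega>)\<^sup>2) * expectation (\<lambda>\<omega>. (Y \<omega>)\<^sup>2) + 2 * (expectation (\<lambda>\<omega>. X \<omega> * Y \<omega>))\<^sup>2"
proof -
  have int1: "integrable M X" "integrable M Y"
    using gauss[of 1 0] gauss[of 0 1] by (simp_all add: integrable_gaussian_rv)
  have lin: "gaussian_rv M (\<lambda>\<omega>. X \<omega> + b * Y \<omega>)" "expectation (\<lambda>\<omega>. X \<omega> + b * Y \<omega>) = 0" for b
    using gauss[of 1 b] int1 mean by simp_all
  have lin_Y: "gaussian_rv M Y" using gauss[of 0 1] by simp
  have pow: "integrable M (\<lambda>\<omega>. (X \<omega> + b * Y \<omega>) ^ k)" for b k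
    using lin by (rule integrable_gaussian_rv_power)
  have pow_X: "integrable M (\<lambda>\<omega>. X \<omega> ^ k)" for k using pow[of 0 k] by simp
  have pow_Y: "integrable M (\<lambda>\<omega>. Y \<omega> ^ k)" for k
    using lin_Y mean(2) by (rule integrable_gaussian_rv_power)
  have m4: "expectation (\<lambda>\<omega>. Z \<omega> ^ 4) = 3 * expectation (\<lambda>\<omega>. (Z \<omega>)\<^sup>2) ^ 2"
    if "gaussian_rv M Z" "expectation Z = 0" for Z
    using expectation_gaussian_rv_even_power[OF that, of 2] by (simp add: fact_numeral)
  \<comment> \<open>The factor \<open>1\<close> keeps the shape \<open>X + b * Y\<close> of the
    facts on powers.\<close>
  have prod: "X \<omega> * Y \<omega> = ((X \<omega> + 1 * Y \<omega>)\<^sup>2 - (X \<omega>)\<^sup>2 - (Y \<omega>)\<^sup>2) / 2" for \<omega>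
    by (simp add: power2_eq_square algebra_simps)
  show intXY: "integrable M (\<lambda>\<omega>. X \<omega> * Y \<omega>)"
    unfolding prod using pow[of 1 2] pow_X[of 2] pow_Y[of 2] by simp
  \<comment> \<open>In the sum of the two fourth powers the odd terms cancel and 12 X^2 Y^2 remains
    beside the pure fourth powers.\<close>
  have polar: "(X \<omega>)\<^sup>2 * (Y \<omega>)\<^sup>2 =
      ((X \<omega> + 1 * Y \<omega>) ^ 4 + (X \<omega> + (-1) * Y \<omega>) ^ 4 - 2 * X \<omega> ^ 4 - 2 * Y \<omega> ^ 4) / 12" for \<omega>
    by algebra
  show "integrable M (\<lambda>\<omega>. (X \<omega>)\<^sup>2 * (Y \<omega>)\<^sup>2)"
    unfolding polar
    by (intro Bochner_Integration.integrable_diff Bochner_Integration.integrable_add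
        integrable_mult_right integrable_divide pow pow_X pow_Y) 
  define u where "u = expectation (\<lambda>\<omega>. (X \<omega>)\<^sup>2)"
  define v where "v = expectation (\<lambda>\<omega>. (Y \<omega>)\<^sup>2)"
  define c where "c = expectation (\<lambda>\<omega>. X \<omega> * Y \<omega>)"
  have second: "expectation (\<lambda>\<omega>. (X \<omega> + b * Y \<omega>)\<^sup>2) = u + 2 * b * c + b\<^sup>2 * v" for b
  proof -
    have "(X \<omega> + b * Y \<omega>)\<^sup>2 = (X \<omega>)\<^sup>2 + 2 * b * (X \<omega> * Y \<omega>) + b\<^sup>2 * (Y \<omega>)\<^sup>2" for \<omega>
      by algebra
    then show ?thesis
      using pow_X[of 2] pow_Y[of 2] intXY by (simp add: u_def v_def c_def)
  qed
  have "expectation (\<lambda>\<omega>. (X \<omega>)\<^sup>2 * (Y \<omega>)\<^sup>2) =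
      (expectation (\<lambda>\<omega>. (X \<omega> + 1 * Y \<omega>) ^ 4) + expectation (\<lambda>\<omega>. (X \<omega> + (-1) * Y \<omega>) ^ 4)
        - 2 * expectation (\<lambda>\<omega>. X \<omega> ^ 4) - 2 * expectation (\<lambda>\<omega>. Y \<omega> ^ 4)) / 12"
    unfolding polar using pow[of 1 4] pow[of "-1" 4] pow_X[of 4] pow_Y[of 4] by simp
  also have "expectation (\<lambda>\<omega>. (X \<omega> + 1 * Y \<omega>) ^ 4) = 3 * (u + 2 * c + v)\<^sup>2"
    using m4[OF lin[of 1]] second[of 1] by simp
  also have "expectation (\<lambda>\<omega>. (X \<omega> + (-1) * Y \<omega>) ^ 4) = 3 * (u - 2 * c + v)\<^sup>2"
    using m4[OF lin[of "-1"]] second[of "-1"] by simp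
  also have "expectation (\<lambda>\<omega>. X \<omega> ^ 4) = 3 * u\<^sup>2"
    using m4[of X] lin[of 0] by (simp add: u_def)
  also have "expectation (\<lambda>\<omega>. Y \<omega> ^ 4) = 3 * v\<^sup>2"
    using m4[OF lin_Y mean(2)] by (simp add: v_def)
  also have "(3 * (u + 2 * c + v)\<^sup>2 + 3 * (u - 2 * c + v)\<^sup>2 - 2 * (3 * u\<^sup>2) - 2 * (3 * v\<^sup>2)) / 12
      = u * v + 2 * c\<^sup>2"
    by (simp add: power2_eq_square algebra_simps)
  finally show "expectation (\<lambda>\<omega>. (X \<omega>)\<^sup>2 * (Y \<omega>)\<^sup>2) =
      expectation (\<lambda>\<omega>. (X \<omega>)\<^sup>2) * expectation (\<lambda>\<omega>. (Y \<omega>)\<^sup>2) + 2 * (expectation (\<lambda>\<omega>. X \<omega> * Y \<omega>))\<^sup>2"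
    by (simp add: u_def v_def c_def)
qed

lemma (in prob_space) centred_gaussian_family_moments:
  assumes fam: "centred_gaussian_family M K X" and "k \<in> K" "l \<in> K"
  shows "integrable M (\<lambda>\<omega>. X k \<omega> * X l \<omega>)"
    and "integrable M (\<lambda>\<omega>. (X k \<omega>)\<^sup>2 * (X l \<omega>)\<^sup>2)"
    and "expectation (\<lambda>\<omega>. (X k \<omega>)\<^sup>2 * (X l \<omega>)\<^sup>2) =
      expectation (\<lambda>\<omega>. (X k \<omega>)\<^sup>2) * expectation (\<lambda>\<omega>. (X l \<omega>)\<^sup>2)
      + 2 * (expectation (\<lambda>\<omega>. X k \<omega> * X l \<omega>))\<^sup>2"
proof -
  have gauss: "gaussian_rv M (\<lambda>\<omega>. a * X k \<omega> + b * X l \<omega>)" for a b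
  \<comment> \<open>For equal indices the set \<open>{k, l}\<close> collapses, and the coefficients
    must be added.\<close>
  proof (cases "k = l")
    case True
    then show ?thesis
      using centred_gaussian_family_lincomb(1)[OF fam, of "{k}" "\<lambda>_. a + b"] assms
      by (simp add: algebra_simps)
  next
    case False
    then show ?thesis
      using centred_gaussian_family_lincomb(1)[OF fam, of "{k, l}" "\<lambda>t. if t = k then a else b"]
        assms by (simp cong: if_cong)
  qed
  have "expectation (X k) = 0" "expectation (X l) = 0"
    using assms by (simp_all add: centred_gaussian_family_def)
  note * = gaussian_pair_moments[OF gauss this]
  show "integrable M (\<lambda>\<omega>. X k \<omega> * X l \<omega>)"
    and "integrable M (\<lambda>\<omega>. (X k \<omega>)\<^sup>2 * (X l \<omega>)\<^sup>2)"
    and "expectation (\<lambda>\<omega>. (X k \<omega>)\<^sup>2 * (X l \<omega>)\<^sup>2) =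
      expectation (\<lambda>\<omega>. (X k \<omega>)\<^sup>2) * expectation (\<lambda>\<omega>. (X l \<omega>)\<^sup>2)
      + 2 * (expectation (\<lambda>\<omega>. X k \<omega> * X l \<omega>))\<^sup>2"
    by (rule *)+
qed

subsection \<open>Weighted averages of squared Gaussian variables\<close>

context
  fixes M :: "'a measure" and K :: "'k set" and X :: "'k \<Rightarrow> 'a \<Rightarrow> real"
    and p :: "'k \<Rightarrow> real" and v :: real
  assumes prob: "prob_space M"
    and fam: "centred_gaussian_family M K X"
    and var: "\<And>k. k \<in> K \<Longrightarrow> (LINT \<omega>|M. (X k \<omega>)\<^sup>2) = v"
    and K: "finite K" and p_sum: "(\<Sum>k\<in>K. p k) = 1"
begin

interpretation prob_space M by (rule prob)

lemma weighted_squares_centred: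
  "(\<Sum>k\<in>K. p k * (X k \<omega>)\<^sup>2) - v = (\<Sum>k\<in>K. p k * ((X k \<omega>)\<^sup>2 - v))"
  using p_sum by (simp add: right_diff_distrib sum_subtractf sum_distrib_right[symmetric])

lemma integrable_family_power: "k \<in> K \<Longrightarrow> integrable M (\<lambda>\<omega>. X k \<omega> ^ j)"
  using fam by (auto simp: centred_gaussian_family_def
      intro!: integrable_gaussian_rv_power gaussian_process_on_component)

text \<open>Expand the square of the centred sum; by the Isserlis formula the product of second
  moments cancels against \<open>v\<^sup>2\<close>, leaving twice the squared covariance in each
  term.\<close>

lemma weighted_squares_variance:
  "expectation (\<lambda>\<omega>. ((\<Sum>k\<in>K. p k * (X k \<omega>)\<^sup>2) - v)\<^sup>2) =
     2 * (\<Sum>k\<in>K. \<Sum>l\<in>K. p k * p l * (expectation (\<lambda>\<omega>. X k \<omega> * X l \<omega>))\<^sup>2)"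
proof -
  have expand: "((\<Sum>k\<in>K. p k * (X k \<omega>)\<^sup>2) - v)\<^sup>2 =
      (\<Sum>k\<in>K. \<Sum>l\<in>K. p k * p l * (((X k \<omega>)\<^sup>2 - v) * ((X l \<omega>)\<^sup>2 - v)))" for \<omega>
    unfolding weighted_squares_centred by (simp add: power2_eq_square sum_product mult_ac)
  have cov: "integrable M (\<lambda>\<omega>. ((X k \<omega>)\<^sup>2 - v) * ((X l \<omega>)\<^sup>2 - v))"
    "expectation (\<lambda>\<omega>. ((X k \<omega>)\<^sup>2 - v) * ((X l \<omega>)\<^sup>2 - v)) =
      2 * (expectation (\<lambda>\<omega>. X k \<omega> * X l \<omega>))\<^sup>2" if "k \<in> K" "l \<in> K" for k l
  proof -
    have eq: "((X k \<omega>)\<^sup>2 - v) * ((X l \<omega>)\<^sup>2 - v) =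
        (X k \<omega>)\<^sup>2 * (X l \<omega>)\<^sup>2 - v * (X k \<omega>)\<^sup>2 - v * (X l \<omega>)\<^sup>2 + v\<^sup>2" for \<omega>
      by algebra
    note i = integrable_family_power[OF that(1), of 2] integrable_family_power[OF that(2), of 2]
      centred_gaussian_family_moments(2)[OF fam that]
    show "integrable M (\<lambda>\<omega>. ((X k \<omega>)\<^sup>2 - v) * ((X l \<omega>)\<^sup>2 - v))"
      unfolding eq using i by simp
    show "expectation (\<lambda>\<omega>. ((X k \<omega>)\<^sup>2 - v) * ((X l \<omega>)\<^sup>2 - v)) =
      2 * (expectation (\<lambda>\<omega>. X k \<omega> * X l \<omega>))\<^sup>2"
      unfolding eq using i
      by (simp add: centred_gaussian_family_moments(3)[OF fam that] var that prob_space
          power2_eq_square[of v])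
  qed
  show ?thesis
    unfolding expand using cov
    by (simp add: Bochner_Integration.integral_sum sum_distrib_left mult_ac)
qed

text \<open>Jensen's inequality for the convex function t^4 reduces the average to single variables,
  so the bound is independent of the weights, the correlations and the size of
  \<open>K\<close>.\<close>

lemma weighted_squares_fourth_moment:
  assumes p_nonneg: "\<And>k. k \<in> K \<Longrightarrow> 0 \<le> p k"
  shows "integrable M (\<lambda>\<omega>. ((\<Sum>k\<in>K. p k * (X k \<omega>)\<^sup>2) - v) ^ 4)"
    and "expectation (\<lambda>\<omega>. ((\<Sum>k\<in>K. p k * (X k \<omega>)\<^sup>2) - v) ^ 4) \<le> 60 * v ^ 4"
proof -
  have [measurable]: "X k \<in> borel_measurable M" if "k \<in> K" for k
    using integrable_family_power[OF that, of 1] by auto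
  have jensen: "((\<Sum>k\<in>K. p k * (X k \<omega>)\<^sup>2) - v) ^ 4 \<le> (\<Sum>k\<in>K. p k * ((X k \<omega>)\<^sup>2 - v) ^ 4)" for \<omega>
  proof -
    have "K \<noteq> {}" using p_sum by auto
    then show ?thesis
      unfolding weighted_squares_centred
      using convex_on_sum[OF K _ convex_power_even[of 4] p_sum p_nonneg, of "\<lambda>k. (X k \<omega>)\<^sup>2 - v"]
      by simp
  qed
  have each: "integrable M (\<lambda>\<omega>. ((X k \<omega>)\<^sup>2 - v) ^ 4)"
    "expectation (\<lambda>\<omega>. ((X k \<omega>)\<^sup>2 - v) ^ 4) = 60 * v ^ 4" if "k \<in> K" for k
  proof -
    have eq: "((X k \<omega>)\<^sup>2 - v) ^ 4 =
        X k \<omega> ^ 8 - 4 * v * X k \<omega> ^ 6 + 6 * v\<^sup>2 * X k \<omega> ^ 4 - 4 * v ^ 3 * (X k \<omega>)\<^sup>2 + v ^ 4" for \<omega>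
      by algebra
    note i = integrable_family_power[OF that]
    have gauss: "gaussian_rv M (X k)" "expectation (X k) = 0"
      using fam that by (auto simp: centred_gaussian_family_def gaussian_process_on_component)
    note m = expectation_gaussian_rv_even_power[OF gauss, unfolded var[OF that]]
    have m4: "expectation (\<lambda>\<omega>. X k \<omega> ^ 4) = 3 * v\<^sup>2"
      using m[of 2] by (simp add: fact_numeral)
    have m6: "expectation (\<lambda>\<omega>. X k \<omega> ^ 6) = 15 * v ^ 3"
      using m[of 3] by (simp add: fact_numeral)
    have m8: "expectation (\<lambda>\<omega>. X k \<omega> ^ 8) = 105 * v ^ 4"
      using m[of 4] by (simp add: fact_numeral)
    show "integrable M (\<lambda>\<omega>. ((X k \<omega>)\<^sup>2 - v) ^ 4)"
      unfolding eq using i[of 2] i[of 4] i[of 6] i[of 8] by simp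
    \<comment> \<open>The normal moments 3, 15, 105 give 105 - 60 + 18 - 4 + 1 = 60.\<close>
    have "expectation (\<lambda>\<omega>. ((X k \<omega>)\<^sup>2 - v) ^ 4) =
        105 * v ^ 4 - 4 * v * (15 * v ^ 3) + 6 * v\<^sup>2 * (3 * v\<^sup>2) - 4 * v ^ 3 * v + v ^ 4"
      unfolding eq using i[of 2] i[of 4] i[of 6] i[of 8]
      by (simp add: m4 m6 m8 var[OF that] prob_space)
    also have "\<dots> = 60 * v ^ 4" by algebra
    finally show "expectation (\<lambda>\<omega>. ((X k \<omega>)\<^sup>2 - v) ^ 4) = 60 * v ^ 4" .
  qed
  have int: "integrable M (\<lambda>\<omega>. \<Sum>k\<in>K. p k * ((X k \<omega>)\<^sup>2 - v) ^ 4)"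
    using each(1) by simp
  show int4: "integrable M (\<lambda>\<omega>. ((\<Sum>k\<in>K. p k * (X k \<omega>)\<^sup>2) - v) ^ 4)"
    by (rule Bochner_Integration.integrable_bound[OF int])
      (auto intro!: AE_I2 order_trans[OF jensen])
  have "expectation (\<lambda>\<omega>. ((\<Sum>k\<in>K. p k * (X k \<omega>)\<^sup>2) - v) ^ 4)
      \<le> expectation (\<lambda>\<omega>. \<Sum>k\<in>K. p k * ((X k \<omega>)\<^sup>2 - v) ^ 4)"
    by (rule integral_mono[OF int4 int jensen])
  also have "\<dots> = (\<Sum>k\<in>K. p k * (60 * v ^ 4))"
    using each by simp
  also have "\<dots> = 60 * v ^ 4"
    using p_sum by (simp add: sum_distrib_right[symmetric])
  finally show "expectation (\<lambda>\<omega>. ((\<Sum>k\<in>K. p k * (X k \<omega>)\<^sup>2) - v) ^ 4) \<le> 60 * v ^ 4" .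
qed

end

subsection \<open>Convergence in probability and second moments\<close>

text \<open>A Paley-Zygmund argument: under a bound on fourth moments, a second moment bounded below
  cannot be carried by events of vanishing probability, so one fixed deviation keeps a probability
  bounded away from \<open>0\<close>.\<close>

lemma (in prob_space) not_converges_in_probability:
  assumes meas: "\<And>n. N \<le> n \<Longrightarrow> Z n \<in> borel_measurable M"
    and int4: "\<And>n. N \<le> n \<Longrightarrow> integrable M (\<lambda>\<omega>. (Z n \<omega> - c) ^ 4)"
    and upper: "\<And>n. N \<le> n \<Longrightarrow> expectation (\<lambda>\<omega>. (Z n \<omega> - c) ^ 4) \<le> B"
    and lower: "\<And>n. N \<le> n \<Longrightarrow> v \<le> expectation (\<lambda>\<omega>. (Z n \<omega> - c)\<^sup>2)"
    and v: "0 < v"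
  shows "\<not> converges_in_probability M Z c"
proof
  assume conv: "converges_in_probability M Z c"
  \<comment> \<open>The constants are chosen so that \<epsilon>^2 and \<open>\<eta> * B\<close> each
    use up at most a quarter of \<open>v\<close>; the remaining half must come from the probability
    of \<open>A n\<close>. The term \<open>\<bar>B\<bar> + 1\<close> makes the denominator
    positive.\<close>
  define \<epsilon> where "\<epsilon> = sqrt (v / 4)"
  define \<eta> where "\<eta> = v / (4 * (\<bar>B\<bar> + 1))"
  define A where "A n = {\<omega> \<in> space M. \<epsilon> < \<bar>Z n \<omega> - c\<bar>}" for n
  have pos: "0 < \<epsilon>" "0 < \<eta>" using v by (auto simp: \<epsilon>_def \<eta>_def)
  have "\<epsilon>\<^sup>2 = v / 4" using v by (simp add: \<epsilon>_def)
  have "\<eta> * B \<le> \<eta> * (\<bar>B\<bar> + 1)" using pos by (intro mult_left_mono) auto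
  also have "\<dots> = v / 4"
    using add_pos_nonneg[of 1 "\<bar>B\<bar>"] by (simp add: \<eta>_def divide_simps)
  finally have "\<eta> * B \<le> v / 4" .
  have bound: "2 * \<eta> * v \<le> prob (A n)" if "N \<le> n" for n
  proof -
    note [measurable] = meas[OF that]
    have A[measurable]: "A n \<in> sets M" unfolding A_def by measurable
    \<comment> \<open>Outside \<open>A n\<close> the deviation is at most \<epsilon>; on
      \<open>A n\<close> completing the square gives t^2 \<le> \<eta> t^4 + 1/(4 \<eta>).\<close>
    have pointwise: "(Z n \<omega> - c)\<^sup>2 \<le> \<epsilon>\<^sup>2 + \<eta> * (Z n \<omega> - c) ^ 4 + indicator (A n) \<omega> / (4 * \<eta>)"
      if "\<omega> \<in> space M" for \<omega>
    proof (cases "\<omega> \<in> A n")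
      case True
      have "0 \<le> (2 * \<eta> * (Z n \<omega> - c)\<^sup>2 - 1)\<^sup>2 / (4 * \<eta>)" using pos by simp
      also have "\<dots> = \<eta> * (Z n \<omega> - c) ^ 4 + 1 / (4 * \<eta>) - (Z n \<omega> - c)\<^sup>2"
        using pos by (simp add: field_simps power2_eq_square power4_eq_xxxx)
      finally have "(Z n \<omega> - c)\<^sup>2 \<le> \<eta> * (Z n \<omega> - c) ^ 4 + 1 / (4 * \<eta>)" by simp
      moreover have "0 \<le> \<epsilon>\<^sup>2" by simp
      ultimately show ?thesis using True by (simp only: indicator_simps)
    next
      case False
      then have "\<bar>Z n \<omega> - c\<bar> \<le> \<epsilon>" using that by (auto simp: A_def)
      then have "(Z n \<omega> - c)\<^sup>2 \<le> \<epsilon>\<^sup>2" by (rule abs_le_square_iff[THEN iffD1, OF order_trans]) simp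
      moreover have "0 \<le> \<eta> * (Z n \<omega> - c) ^ 4" using pos by simp
      ultimately show ?thesis using False by simp
    qed
    have int2: "integrable M (\<lambda>\<omega>. (Z n \<omega> - c)\<^sup>2)"
    proof (rule Bochner_Integration.integrable_bound)
      show "integrable M (\<lambda>\<omega>. 1 + (Z n \<omega> - c) ^ 4)" using int4[OF that] by simp
      have "t\<^sup>2 \<le> 1 + t ^ 4" for t :: real
      proof -
        have "0 \<le> (t\<^sup>2 - 1)\<^sup>2 + t\<^sup>2" by simp
        also have "\<dots> = 1 + t ^ 4 - t\<^sup>2" by algebra
        finally show ?thesis by simp
      qed
      then show "AE \<omega> in M. norm ((Z n \<omega> - c)\<^sup>2) \<le> norm (1 + (Z n \<omega> - c) ^ 4)" by simp
    qed simp
    have "v \<le> expectation (\<lambda>\<omega>. (Z n \<omega> - c)\<^sup>2)" by (rule lower[OF that])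
    also have "\<dots> \<le> expectation (\<lambda>\<omega>. \<epsilon>\<^sup>2 + \<eta> * (Z n \<omega> - c) ^ 4 + indicator (A n) \<omega> / (4 * \<eta>))"
      using int4[OF that] pointwise A int2
      by (intro integral_mono)
        (auto intro!: Bochner_Integration.integrable_add integrable_divide integrable_real_indicator
          simp: emeasure_finite less_top[symmetric])
    also have "\<dots> = \<epsilon>\<^sup>2 + \<eta> * expectation (\<lambda>\<omega>. (Z n \<omega> - c) ^ 4) + prob (A n) / (4 * \<eta>)"
      using int4[OF that] A by (simp add: prob_space emeasure_finite less_top[symmetric])
    also have "\<dots> \<le> v / 4 + v / 4 + prob (A n) / (4 * \<eta>)"
      using mult_left_mono[OF upper[OF that], of \<eta>] pos \<open>\<eta> * B \<le> v / 4\<close> \<open>\<epsilon>\<^sup>2 = v / 4\<close>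
      by linarith
    finally have "v / 2 \<le> prob (A n) / (4 * \<eta>)" by simp
    then show ?thesis using pos by (simp add: field_simps)
  qed
  have "(\<lambda>n. prob (A n)) \<longlonglongrightarrow> 0"
    using conv pos unfolding converges_in_probability_def A_def by blast
  moreover have "0 < 2 * \<eta> * v" using pos v by simp
  ultimately have "\<forall>\<^sub>F n in sequentially. prob (A n) < 2 * \<eta> * v"
    by (rule order_tendstoD)
  then obtain n where "N \<le> n" "prob (A n) < 2 * \<eta> * v"
    unfolding eventually_sequentially by (meson nle_le)
  then show False using bound by force
qed

subsection \<open>Correlation functions\<close>

lemma compact_unit_cube: "compact (unit_cube :: (real ^ 'd) set)"
proof -
  have "(unit_cube :: (real ^ 'd) set) = cbox 0 1"
    by (auto simp: unit_cube_def mem_box_cart)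
  then show ?thesis by (metis compact_cbox)
qed

text \<open>The mass of one of finitely many small cells, on which \<open>C\<^sup>2\<close> is at least \<open>1/4\<close>, cannot be
  small, and all remaining terms of the quadratic form are nonnegative.\<close>

lemma squared_correlation_form_lower_bound:
  fixes C :: "'v::real_normed_vector \<Rightarrow> real"
  assumes cont: "isCont C 0" and C0: "C 0 = 1" and T: "compact T"
  shows "\<exists>\<kappa>>0. \<forall>(I :: 'i set) q f. finite I \<longrightarrow> (\<forall>i\<in>I. 0 \<le> q i) \<longrightarrow> f ` I \<subseteq> T \<longrightarrow>
           \<kappa> * (\<Sum>i\<in>I. q i)\<^sup>2 \<le> (\<Sum>i\<in>I. \<Sum>j\<in>I. q i * q j * (C (f i - f j))\<^sup>2)"
proof -
  have half: "\<forall>\<^sub>F h in at 0. 1 / 2 < C h"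
    using cont C0 by (intro order_tendstoD(1)[of C 1]) (auto simp: isCont_def)
  \<comment> \<open>The filter \<open>at 0\<close> omits the origin, where \<open>C 0 = 1\<close> is
    used instead.\<close>
  obtain \<delta> where \<delta>: "0 < \<delta>" and near: "\<And>h. norm h < \<delta> \<Longrightarrow> 1 / 2 < C h"
  proof -
    obtain \<delta> where "0 < \<delta>" "\<And>h. h \<noteq> 0 \<Longrightarrow> norm h < \<delta> \<Longrightarrow> 1 / 2 < C h"
      using half unfolding eventually_at by (auto simp: dist_norm)
    then have "1 / 2 < C h" if "norm h < \<delta>" for h
      using C0 that by (cases "h = 0") auto
    with \<open>0 < \<delta>\<close> show thesis by (rule that)
  qed
  \<comment> \<open>With radius \<open>\<delta> / 2\<close>, two points of one ball differ by less
    than \<delta>.\<close>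
  obtain G where G: "finite G" "T \<subseteq> (\<Union>g\<in>G. ball g (\<delta> / 2))"
    using compactE_image[OF T, of T "\<lambda>g. ball g (\<delta> / 2)"] \<delta>
    by (metis (no_types, lifting) UN_I centre_in_ball half_gt_zero open_ball subsetI)
  \<comment> \<open>The factor 4 comes from \<open>C\<^sup>2\<close> being at least 1/4 within a
    cell, \<open>card G\<close> from Cauchy-Schwarz over the cells; adding 1 keeps the denominator
    positive also for empty \<open>G\<close>.\<close>
  define \<kappa> where "\<kappa> = 1 / (4 * (real (card G) + 1))"
  have "\<kappa> * (\<Sum>i\<in>I. q i)\<^sup>2 \<le> (\<Sum>i\<in>I. \<Sum>j\<in>I. q i * q j * (C (f i - f j))\<^sup>2)"
    if I: "finite I" and q: "\<And>i. i \<in> I \<Longrightarrow> 0 \<le> q i" and f: "f ` I \<subseteq> T" for I :: "'i set" and q f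
  proof -
    have "\<exists>g. g \<in> G \<and> dist g (f i) < \<delta> / 2" if "i \<in> I" for i
      using G(2) f that by (auto simp: subset_iff) 
    \<comment> \<open>The balls may overlap; choosing one centre per index turns them into a
      partition of \<open>I\<close>.\<close>
    then obtain c where c: "\<And>i. i \<in> I \<Longrightarrow> c i \<in> G" "\<And>i. i \<in> I \<Longrightarrow> dist (c i) (f i) < \<delta> / 2"
      by metis
    define m where "m g = (\<Sum>i\<in>{i \<in> I. c i = g}. q i)" for g
    have total: "(\<Sum>i\<in>I. q i) = (\<Sum>g\<in>G. m g)"
      unfolding m_def using sum.group[OF I G(1), of c q] c by (simp add: image_subset_iff)
    have "(\<Sum>i\<in>I. q i)\<^sup>2 \<le> (\<Sum>g\<in>G. (m g)\<^sup>2) * card G"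
      unfolding total by (rule sum_squared_le_sum_of_squares)
    also have "\<dots> \<le> (\<Sum>g\<in>G. (m g)\<^sup>2) * (real (card G) + 1)"
      by (intro mult_left_mono sum_nonneg) auto
    finally have "\<kappa> * (\<Sum>i\<in>I. q i)\<^sup>2 \<le> (\<Sum>g\<in>G. (m g)\<^sup>2) / 4"
      by (simp add: \<kappa>_def field_simps)
    also have "(\<Sum>g\<in>G. (m g)\<^sup>2) = (\<Sum>g\<in>G. \<Sum>i\<in>{i \<in> I. c i = g}. \<Sum>j\<in>{j \<in> I. c j = g}. q i * q j)"
      by (simp add: m_def power2_eq_square sum_product)
    \<comment> \<open>Once the inner condition no longer mentions \<open>g\<close>, the two outer
      sums merge into one over \<open>I\<close>.\<close>
    also have "\<dots> = (\<Sum>g\<in>G. \<Sum>i\<in>{i \<in> I. c i = g}. \<Sum>j\<in>{j \<in> I. c j = c i}. q i * q j)"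
      by (intro sum.cong refl) auto
    also have "\<dots> = (\<Sum>i\<in>I. \<Sum>j\<in>{j \<in> I. c j = c i}. q i * q j)"
      by (rule sum.group[OF I G(1)]) (use c in auto)
    also have "\<dots> / 4 = (\<Sum>i\<in>I. \<Sum>j\<in>{j \<in> I. c j = c i}. q i * q j * (1 / 4))"
      by (simp add: sum_divide_distrib)
    also have "\<dots> \<le> (\<Sum>i\<in>I. \<Sum>j\<in>{j \<in> I. c j = c i}. q i * q j * (C (f i - f j))\<^sup>2)"
    proof (intro sum_mono mult_left_mono)
      fix i j assume ij: "i \<in> I" "j \<in> {j \<in> I. c j = c i}"
      have "dist (f i) (f j) < \<delta>"
        using c(2)[of i] c(2)[of j] ij dist_triangle_half_r[of "c i" "f i" \<delta> "f j"]
        by (simp add: dist_commute)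
      then have "1 / 2 < C (f i - f j)" by (intro near) (simp add: dist_norm)
      then have "(1 / 2)\<^sup>2 \<le> (C (f i - f j))\<^sup>2" by (intro power_mono) auto
      then show "1 / 4 \<le> (C (f i - f j))\<^sup>2" by (simp add: power2_eq_square)
      show "0 \<le> q i * q j" using q ij by simp
    qed
    also have "\<dots> \<le> (\<Sum>i\<in>I. \<Sum>j\<in>I. q i * q j * (C (f i - f j))\<^sup>2)"
      using I q by (intro sum_mono sum_mono2) auto
    finally show ?thesis .
  qed
  moreover have "0 < \<kappa>" by (simp add: \<kappa>_def)
  ultimately show ?thesis
    by (intro exI[of _ \<kappa>] conjI allI impI) simp_all
qed

text \<open>Positive semi-definiteness at \<open>0, h, 2h\<close> with coefficients \<open>1, -2 C(h), 1\<close>.\<close>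

lemma stationary_correlation_square_less_1:
  assumes C: "stationary_correlation C" and less: "\<And>h. h \<noteq> 0 \<Longrightarrow> C h < 1" and "h \<noteq> 0"
  shows "(C h)\<^sup>2 < 1"
proof -
  define a where "a i = (if i = 1 then - 2 * C h else 1)" for i :: nat
  have sym: "C (- y) = C y" for y
    using C unfolding stationary_correlation_def by (metis diff_0 diff_zero)
  have "0 \<le> (\<Sum>i<3. \<Sum>j<3. a i * a j * C (real i *\<^sub>R h - real j *\<^sub>R h))"
    using C unfolding stationary_correlation_def
    by (elim conjE allE[of _ "3::nat"] allE[of _ "\<lambda>i. real i *\<^sub>R h"] allE[of _ a])
  also have "\<dots> = (\<Sum>i<3. \<Sum>j<3. a i * a j * C ((real i - real j) *\<^sub>R h))"
    by (simp add: scaleR_left_diff_distrib)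
  \<comment> \<open>The diagonal gives 2 + 4 C(h)^2, the neighbouring points -8 C(h)^2, the two ends
    2 C(2h). With C(2h) < 1 this also excludes C(h) = -1, which C(h) < 1 alone leaves open.\<close>
  also have "\<dots> = 2 - 4 * (C h)\<^sup>2 + 2 * C (2 *\<^sub>R h)"
  proof -
    have "C 0 = 1" using C by (simp add: stationary_correlation_def)
    then show ?thesis
      using sym[of h] sym[of "2 *\<^sub>R h"]
      by (simp add: a_def numeral_3_eq_3 power2_eq_square)
  qed
  finally have "4 * (C h)\<^sup>2 \<le> 2 + 2 * C (2 *\<^sub>R h)" by simp
  moreover have "C (2 *\<^sub>R h) < 1" using \<open>h \<noteq> 0\<close> by (intro less) simp
  ultimately show ?thesis by simp
qed

section \<open>Minimisation of the pairwise likelihood in the variance\<close>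

text \<open>A minimiser on the open half-line is a critical point, and the derivative 2W/s - A/s^2
  can vanish at only one positive \<open>s\<close>.\<close>

lemma is_arg_min_log_likelihood:
  fixes W A :: real
  assumes min: "is_arg_min (\<lambda>s. 2 * W * ln s + L + A / s) (\<lambda>s. 0 < s) s" and W: "0 < W"
  shows "s = A / (2 * W)"
proof -
  have s: "0 < s" using min by (simp add: is_arg_min_def)
  have le: "2 * W * ln s + L + A / s \<le> 2 * W * ln t + L + A / t" if "0 < t" for t
    using min that unfolding is_arg_min_def by (meson not_less)
  have "((\<lambda>s. 2 * W * ln s + L + A / s) has_real_derivative 2 * W / s - A / s\<^sup>2) (at s)"
    using s by (auto intro!: derivative_eq_intros simp: power2_eq_square field_simps)
  \<comment> \<open>The radius \<open>s\<close> of the neighbourhood ensures that every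
    \<open>t\<close> in it is positive.\<close>
  then have "2 * W / s - A / s\<^sup>2 = 0"
  proof (rule DERIV_local_min[OF _ s])
    show "\<forall>t. \<bar>s - t\<bar> < s \<longrightarrow> 2 * W * ln s + L + A / s \<le> 2 * W * ln t + L + A / t"
      by (intro allI impI le) linarith
  qed
  then show ?thesis using s W by (simp add: field_simps power2_eq_square)
qed

section \<open>Non-convergence of the pairwise likelihood estimator\<close>

theorem theorem4:
  fixes C :: "real ^ 'd \<Rightarrow> real"
    and M :: "'a measure"
    and Y :: "real ^ 'd \<Rightarrow> 'a \<Rightarrow> real"
    and \<sigma>0sq :: real
    and x :: "nat \<Rightarrow> real ^ 'd"
    and w :: "nat \<Rightarrow> nat \<Rightarrow> nat \<Rightarrow> real"
    and \<sigma>hat :: "nat \<Rightarrow> 'a \<Rightarrow> real"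
  assumes "stationary_correlation C"
    and "continuous_on UNIV C"
    and "entropy_integral unit_cube (corr_dist C) < \<infinity>"
    and "\<exists>F P. is_fourier_transform C F \<and>
           filterlim (\<lambda>v. F v * norm v powr P) at_top at_infinity"
    and "C 0 = 1" and "\<And>h. h \<noteq> 0 \<Longrightarrow> C h < 1"
    and "prob_space M"
    and "0 < \<sigma>0sq"
    and "gaussian_process_on M unit_cube Y"
    and "\<And>t. t \<in> unit_cube \<Longrightarrow> (LINT \<omega>|M. Y t \<omega>) = 0"
    and "\<And>t t'. t \<in> unit_cube \<Longrightarrow> t' \<in> unit_cube \<Longrightarrow>
           covariance M (Y t) (Y t') = \<sigma>0sq * C (t - t')"
    and "\<And>i. 1 \<le> i \<Longrightarrow> x i \<in> unit_cube"
    and "inj_on x {1..}"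
    and "\<And>n i j. 1 \<le> i \<Longrightarrow> i < j \<Longrightarrow> j \<le> n \<Longrightarrow> 0 \<le> w n i j"
    and "\<And>n. 2 \<le> n \<Longrightarrow> \<exists>i j. 1 \<le> i \<and> i < j \<and> j \<le> n \<and> w n i j \<noteq> 0"
    and "\<And>n. 2 \<le> n \<Longrightarrow> \<sigma>hat n \<in> borel_measurable M"
    and "\<And>n. 2 \<le> n \<Longrightarrow> AE \<omega> in M.
           is_arg_min (pairwise_lik C (\<lambda>t. Y t \<omega>) x (w n) n) (\<lambda>s. 0 < s) (\<sigma>hat n \<omega>)"
  shows "\<not> converges_in_probability M \<sigma>hat \<sigma>0sq"
proof -
  interpret prob_space M by fact
  have fam: "centred_gaussian_family M unit_cube Y"
    using assms(9,10) by (simp add: centred_gaussian_family_def)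
  have cov: "expectation (\<lambda>\<omega>. Y t \<omega> * Y t' \<omega>) = \<sigma>0sq * C (t - t')"
    if "t \<in> unit_cube" "t' \<in> unit_cube" for t t'
    using assms(11)[OF that] assms(10) that by (simp add: covariance_def)
  have "isCont C 0" using assms(2) by (simp add: continuous_on_eq_continuous_at)
  \<comment> \<open>The constant \<kappa> is fixed before \<open>n\<close> and the weights, which
    makes the variance bound uniform.\<close>
  from squared_correlation_form_lower_bound[of C, OF this assms(5) compact_unit_cube]
  obtain \<kappa> where \<kappa>: "0 < \<kappa>"
    and form: "\<forall>(I :: (nat \<times> nat) set) q f.
        finite I \<longrightarrow> (\<forall>i\<in>I. 0 \<le> q i) \<longrightarrow> f ` I \<subseteq> unit_cube \<longrightarrow>
        \<kappa> * (\<Sum>i\<in>I. q i)\<^sup>2 \<le> (\<Sum>i\<in>I. \<Sum>j\<in>I. q i * q j * (C (f i - f j))\<^sup>2)"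
    by (elim exE conjE) (rule that)
  have key: "integrable M (\<lambda>\<omega>. (\<sigma>hat n \<omega> - \<sigma>0sq) ^ 4) \<and>
      expectation (\<lambda>\<omega>. (\<sigma>hat n \<omega> - \<sigma>0sq) ^ 4) \<le> 60 * \<sigma>0sq ^ 4 \<and>
      \<kappa> * \<sigma>0sq\<^sup>2 / 2 \<le> expectation (\<lambda>\<omega>. (\<sigma>hat n \<omega> - \<sigma>0sq)\<^sup>2)" if n: "2 \<le> n" for n
  proof -
    define P where "P = (SIGMA i:{1..n - 1}. {i + 1..n})"
    have "finite P" by (simp add: P_def)
    have in_P: "1 \<le> i \<and> i < j \<and> j \<le> n" if "(i, j) \<in> P" for i j
      using that by (auto simp: P_def)
    define wt where "wt a = w n (fst a) (snd a)" for a
    have wt_nonneg: "0 \<le> wt a" if "a \<in> P" for a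
      using that in_P[of "fst a" "snd a"] assms(14) by (simp add: wt_def)
    define W where "W = (\<Sum>a\<in>P. wt a)"
    have "0 < W"
    proof -
      obtain i j where ij: "1 \<le> i" "i < j" "j \<le> n" "w n i j \<noteq> 0" using assms(15)[OF n] by blast
      then have "(i, j) \<in> P" by (auto simp: P_def)
      moreover have "0 < wt (i, j)" using ij assms(14)[of i j n] by (simp add: wt_def)
      ultimately show ?thesis
        unfolding W_def using \<open>finite P\<close> wt_nonneg by (intro sum_pos2)
    qed
    define r where "r a = C (x (fst a) - x (snd a))" for a
    have cube: "x (fst a) \<in> unit_cube" "x (snd a) \<in> unit_cube" and
      r_less: "(r a)\<^sup>2 < 1" and distinct: "x (fst a) \<noteq> x (snd a)" if "a \<in> P" for a
    proof -
      have ij: "1 \<le> fst a" "fst a < snd a" using in_P[of "fst a" "snd a"] that by auto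
      then show "x (fst a) \<in> unit_cube" "x (snd a) \<in> unit_cube" using assms(12) by auto
      show "x (fst a) \<noteq> x (snd a)"
        using ij inj_onD[OF assms(13), of "fst a" "snd a"] by auto
      then show "(r a)\<^sup>2 < 1"
        unfolding r_def by (intro stationary_correlation_square_less_1[OF assms(1,6)]) auto
    qed
    \<comment> \<open>\<open>U a\<close> is the first observation of the pair, \<open>V a\<close>
      the residual of the second given the first, scaled to the same variance.\<close>
    define U where "U a \<omega> = Y (x (fst a)) \<omega>" for a :: "nat \<times> nat" and \<omega>
    define V where "V a \<omega> = (Y (x (snd a)) \<omega> - r a * Y (x (fst a)) \<omega>) / sqrt (1 - (r a)\<^sup>2)" for a \<omega>
    define X where "X = case_sum U V"
    \<comment> \<open>The disjoint sum keeps one copy of each pair for \<open>U\<close> and one for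
      \<open>V\<close>. Each copy has total weight 1/2, hence the divisor
      \<open>2 * W\<close>.\<close>
    define K where "K = P <+> P"
    define p where "p = case_sum (\<lambda>a. wt a / (2 * W)) (\<lambda>a. wt a / (2 * W))"
    have "finite K" using \<open>finite P\<close> by (simp add: K_def)
    have p_nonneg: "0 \<le> p k" if "k \<in> K" for k
      using that wt_nonneg \<open>0 < W\<close> by (auto simp: K_def p_def)
    have half: "(\<Sum>a\<in>P. wt a / (2 * W)) = 1 / 2"
      using \<open>0 < W\<close> by (simp add: sum_divide_distrib[symmetric] W_def[symmetric])
    have p_sum: "(\<Sum>k\<in>K. p k) = 1"
      using \<open>finite P\<close> half by (simp add: K_def p_def sum.Plus o_def)
    have famX: "centred_gaussian_family M K X"
    proof (rule centred_gaussian_family_transform[OF fam])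
      \<comment> \<open>As the two points of a pair are distinct, \<open>S (Inr a)\<close> has two
        elements and the case distinction assigns each its own coefficient.\<close>
      define b where "b = case_sum
          (\<lambda>a :: nat \<times> nat. \<lambda>t. if t = x (fst a) then 1 else 0)
          (\<lambda>a t. (if t = x (fst a) then - r a else 1) / sqrt (1 - (r a)\<^sup>2))"
      define S where "S k = (case k of Inl a \<Rightarrow> {x (fst a)} | Inr a \<Rightarrow> {x (fst a), x (snd a)})"
        for k :: "(nat \<times> nat) + (nat \<times> nat)"
      fix k assume k: "k \<in> K"
      show "finite (S k)" by (auto simp: S_def split: sum.split)
      show "S k \<subseteq> unit_cube" using k cube by (auto simp: K_def S_def)
      show "X k \<omega> = (\<Sum>t\<in>S k. b k t * Y t \<omega>)" for \<omega>
        using k distinct distinct[symmetric]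
        by (auto simp: K_def X_def S_def b_def U_def V_def diff_divide_distrib)
    qed
    have intY: "integrable M (\<lambda>\<omega>. Y t \<omega> * Y t' \<omega>)" if "t \<in> unit_cube" "t' \<in> unit_cube" for t t'
      using centred_gaussian_family_moments(1)[OF fam that] .
    have var: "expectation (\<lambda>\<omega>. (X k \<omega>)\<^sup>2) = \<sigma>0sq" if "k \<in> K" for k
    proof (cases k)
      case (Inl a)
      then have "a \<in> P" using that by (auto simp: K_def)
      then show ?thesis
        using Inl cov[of "x (fst a)" "x (fst a)"] cube(1)[of a] assms(5)
        by (simp add: X_def U_def power2_eq_square)
    next
      case (Inr a)
      then have a: "a \<in> P" using that by (auto simp: K_def)
      let ?u = "x (fst a)" and ?v = "x (snd a)"
      have sq: "(X k \<omega>)\<^sup>2 = (Y ?v \<omega> * Y ?v \<omega> - 2 * r a * (Y ?u \<omega> * Y ?v \<omega>)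
          + (r a)\<^sup>2 * (Y ?u \<omega> * Y ?u \<omega>)) / (1 - (r a)\<^sup>2)" for \<omega>
        using Inr r_less[OF a]
        by (simp add: X_def V_def power_divide) (simp add: power2_eq_square algebra_simps)
      \<comment> \<open>The numerator is \<open>\<sigma>0sq\<close> times 1 - 2 r^2 + r^2, which the
        normalisation cancels.\<close>
      have "expectation (\<lambda>\<omega>. (X k \<omega>)\<^sup>2) =
          (\<sigma>0sq - 2 * r a * (\<sigma>0sq * r a) + (r a)\<^sup>2 * \<sigma>0sq) / (1 - (r a)\<^sup>2)"
        unfolding sq using cube[OF a] assms(5) by (simp add: intY cov r_def)
      also have "\<dots> = \<sigma>0sq" using r_less[OF a] by (simp add: field_simps power2_eq_square)
      finally show ?thesis .
    qed
    define Z where "Z \<omega> = (\<Sum>k\<in>K. p k * (X k \<omega>)\<^sup>2)" for \<omega>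
    have Z: "Z \<omega> = (\<Sum>a\<in>P. wt a * ((U a \<omega>)\<^sup>2 + (V a \<omega>)\<^sup>2)) / (2 * W)" for \<omega>
      using \<open>finite P\<close>
      by (simp add: Z_def K_def p_def X_def sum.Plus o_def sum_divide_distrib sum.distrib[symmetric]
          add_divide_distrib distrib_left)
    have \<sigma>hat_eq: "AE \<omega> in M. \<sigma>hat n \<omega> = Z \<omega>"
      using assms(17)[OF n]
    proof eventually_elim
      case (elim \<omega>)
      define L where "L = (\<Sum>a\<in>P. wt a * ln (1 - (r a)\<^sup>2))"
      define A where "A = (\<Sum>a\<in>P. wt a * ((U a \<omega>)\<^sup>2 + (V a \<omega>)\<^sup>2))"
      \<comment> \<open>The equality is one of functions on all reals; at \<open>s = 0\<close> both
        sides agree because division by zero yields \<open>0\<close>.\<close>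
      have "pairwise_lik C (\<lambda>t. Y t \<omega>) x (w n) n = (\<lambda>s. 2 * W * ln s + L + A / s)"
      proof
        fix s
        have "pairwise_lik C (\<lambda>t. Y t \<omega>) x (w n) n s =
            (\<Sum>a\<in>P. wt a * pair_lik C (\<lambda>t. Y t \<omega>) (x (fst a)) (x (snd a)) s)"
          unfolding pairwise_lik_def P_def wt_def by (subst sum.Sigma) (auto simp: case_prod_unfold)
        also have "\<dots> = (\<Sum>a\<in>P. 2 * wt a * ln s + wt a * ln (1 - (r a)\<^sup>2)
            + wt a * ((U a \<omega>)\<^sup>2 + (V a \<omega>)\<^sup>2) / s)"
        proof (rule sum.cong[OF refl])
          fix a assume a: "a \<in> P"
          have "(V a \<omega>)\<^sup>2 / s = (Y (x (snd a)) \<omega> - r a * Y (x (fst a)) \<omega>)\<^sup>2 / (s * (1 - (r a)\<^sup>2))"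
            using r_less[OF a] by (simp add: V_def power_divide mult.commute)
          then show "wt a * pair_lik C (\<lambda>t. Y t \<omega>) (x (fst a)) (x (snd a)) s =
              2 * wt a * ln s + wt a * ln (1 - (r a)\<^sup>2) + wt a * ((U a \<omega>)\<^sup>2 + (V a \<omega>)\<^sup>2) / s"
            unfolding pair_lik_def r_def[symmetric]
            by (simp add: U_def distrib_left add_divide_distrib flip: times_divide_eq_right)
        qed
        also have "\<dots> = 2 * W * ln s + L + A / s"
          by (simp add: sum.distrib W_def L_def A_def sum_distrib_left sum_distrib_right
              sum_divide_distrib)
        finally show "pairwise_lik C (\<lambda>t. Y t \<omega>) x (w n) n s = 2 * W * ln s + L + A / s" .
      qed
      then have "is_arg_min (\<lambda>s. 2 * W * ln s + L + A / s) (\<lambda>s. 0 < s) (\<sigma>hat n \<omega>)"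
        using elim by (simp only:)
      then have "\<sigma>hat n \<omega> = A / (2 * W)"
        using \<open>0 < W\<close> by (rule is_arg_min_log_likelihood)
      then show ?case by (simp add: Z A_def)
    qed
    note assms(16)[OF n, measurable]
    have [measurable]: "X k \<in> borel_measurable M" if "k \<in> K" for k
      using gaussian_process_on_component[OF _ that, of M X] famX
      by (simp add: centred_gaussian_family_def gaussian_rv_def)
    have [measurable]: "Z \<in> borel_measurable M" unfolding Z_def by measurable
    have transfer: "expectation (\<lambda>\<omega>. (\<sigma>hat n \<omega> - \<sigma>0sq) ^ m) = expectation (\<lambda>\<omega>. (Z \<omega> - \<sigma>0sq) ^ m)"
      "integrable M (\<lambda>\<omega>. (\<sigma>hat n \<omega> - \<sigma>0sq) ^ m) \<longleftrightarrow> integrable M (\<lambda>\<omega>. (Z \<omega> - \<sigma>0sq) ^ m)" for m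
    proof -
      have ae: "AE \<omega> in M. (\<sigma>hat n \<omega> - \<sigma>0sq) ^ m = (Z \<omega> - \<sigma>0sq) ^ m"
        using \<sigma>hat_eq by eventually_elim simp
      show "expectation (\<lambda>\<omega>. (\<sigma>hat n \<omega> - \<sigma>0sq) ^ m) = expectation (\<lambda>\<omega>. (Z \<omega> - \<sigma>0sq) ^ m)"
        by (rule integral_cong_AE[OF _ _ ae]) measurable
      show "integrable M (\<lambda>\<omega>. (\<sigma>hat n \<omega> - \<sigma>0sq) ^ m) \<longleftrightarrow> integrable M (\<lambda>\<omega>. (Z \<omega> - \<sigma>0sq) ^ m)"
        by (rule integrable_cong_AE[OF _ _ ae]) measurable
    qed
    \<comment> \<open>The form bound is applied to the \<open>U\<close> part, of mass 1/2. It
      concerns indexed families, so one site may serve as first point of several pairs.\<close>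
    have "\<kappa> * (1 / 2)\<^sup>2 \<le>
        (\<Sum>a\<in>P. \<Sum>b\<in>P. wt a / (2 * W) * (wt b / (2 * W)) * (C (x (fst a) - x (fst b)))\<^sup>2)"
      using form[rule_format, of P "\<lambda>a. wt a / (2 * W)" "\<lambda>a. x (fst a)"] \<open>finite P\<close> wt_nonneg \<open>0 < W\<close> cube half
      by (auto simp: image_subset_iff)
    then have "\<sigma>0sq\<^sup>2 * (\<kappa> * (1 / 2)\<^sup>2) \<le> \<sigma>0sq\<^sup>2 *
        (\<Sum>a\<in>P. \<Sum>b\<in>P. wt a / (2 * W) * (wt b / (2 * W)) * (C (x (fst a) - x (fst b)))\<^sup>2)"
      by (rule mult_left_mono) simp
    also have "\<dots> = (\<Sum>a\<in>P. \<Sum>b\<in>P. p (Inl a) * p (Inl b) *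
        (expectation (\<lambda>\<omega>. X (Inl a) \<omega> * X (Inl b) \<omega>))\<^sup>2)"
      using cube by (simp add: sum_distrib_left p_def X_def U_def cov power_mult_distrib mult_ac)
    \<comment> \<open>The \<open>U\<close>-\<open>V\<close> terms are added here and the rows
      belonging to \<open>V\<close> in the next step; all of them are nonnegative.\<close>
    also have "\<dots> \<le> (\<Sum>a\<in>P. \<Sum>l\<in>K. p (Inl a) * p l * (expectation (\<lambda>\<omega>. X (Inl a) \<omega> * X l \<omega>))\<^sup>2)"
      unfolding K_def sum.Plus[OF \<open>finite P\<close> \<open>finite P\<close>] o_def
      using p_nonneg by (intro sum_mono) (auto intro!: sum_nonneg mult_nonneg_nonneg simp: K_def)
    also have "\<dots> \<le> (\<Sum>k\<in>K. \<Sum>l\<in>K. p k * p l * (expectation (\<lambda>\<omega>. X k \<omega> * X l \<omega>))\<^sup>2)"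
    proof -
      have "0 \<le> (\<Sum>a\<in>P. \<Sum>l\<in>K. p (Inr a) * p l * (expectation (\<lambda>\<omega>. X (Inr a) \<omega> * X l \<omega>))\<^sup>2)"
        using p_nonneg by (intro sum_nonneg mult_nonneg_nonneg) (auto simp: K_def)
      then show ?thesis
        by (subst (3) K_def) (simp add: sum.Plus[OF \<open>finite P\<close> \<open>finite P\<close>])
    qed
    \<comment> \<open>The factor 2 of the variance formula times (1/2)^2 gives the constant
      1/2.\<close>
    finally have "\<kappa> * \<sigma>0sq\<^sup>2 / 2 \<le>
        2 * (\<Sum>k\<in>K. \<Sum>l\<in>K. p k * p l * (expectation (\<lambda>\<omega>. X k \<omega> * X l \<omega>))\<^sup>2)"
      by (simp add: power2_eq_square[of "1 / 2"] mult.commute)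
    also have "\<dots> = expectation (\<lambda>\<omega>. (Z \<omega> - \<sigma>0sq)\<^sup>2)"
      unfolding Z_def
      by (rule weighted_squares_variance[OF prob_space_axioms famX var \<open>finite K\<close> p_sum, symmetric])
    finally show ?thesis
      unfolding transfer
      using weighted_squares_fourth_moment[OF prob_space_axioms famX var \<open>finite K\<close> p_sum p_nonneg]
      by (simp add: Z_def)
  qed
  show ?thesis
  proof (rule not_converges_in_probability)
    show "\<sigma>hat n \<in> borel_measurable M" if "2 \<le> n" for n using assms(16)[OF that] .
    show "0 < \<kappa> * \<sigma>0sq\<^sup>2 / 2" using \<kappa> assms(8) by simp
  qed (use key in blast)+
qed

end
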